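(* For every integer $k>0$, $\mathfrak{b}(\mathbf{L}_\forall^k)=\mathfrak{b}$ and $\mathfrak{d}(\mathbf{L}_\forall^k)=\mathfrak{d}$, while $\mathfrak{b}(\mathbf{L}_\exists^k)=\mathfrak{d}$ and $\mathfrak{d}(\mathbf{L}_\exists^k)=\mathfrak{b}$ for every $k<\omega$ (including $k=0$).
   Context: A relational system $\mathbf{R}=\langle X,Y,\sqsubset\rangle$ consists of two non-empty sets $X,Y$ and a relation $\sqsubset$ between elements of $X$ and elements of $Y$. A set $F\subseteq X$ is $\mathbf{R}$-bounded if $\exists y\in Y\,\forall x\in F\; x\sqsubset y$, and $\mathbf{R}$-unbounded otherwise; $E\subseteq Y$ is $\mathbf{R}$-dominating if $\forall x\in X\,\exists y\in E\; x\sqsubset y$. Put $\mathfrak{b}(\mathbf{R})=\min\{|F|: F\subseteq X \text{ is } \mathbf{R}\text{-unbounded}\}$ and $\mathfrak{d}(\mathbf{R})=\min\{|D|: D\subseteq Y\text{ is }\mathbf{R}\text{-dominating}\}$. $\omega^{\uparrow\omega}$ is the set of strictly increasing functions $\omega\to\omega$; $[a,b)=\{m\in\omega: a\le m<b\}$; $\forall^\infty n$ means "for all but finitely many $n\in\omega$", $\exists^\infty n$ means "for infinitely many $n\in\omega$". $\mathfrak{b}$ and $\mathfrak{d}$ denote $\mathfrak{b}(\mathbf{D})$ and $\mathfrak{d}(\mathbf{D})$ for $\mathbf{D}=\langle\omega^{\uparrow\omega},\omega^{\uparrow\omega},\le^*\rangle$, where $x\le^* y$ means $\forall^\infty n\;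 x(n)\le y(n)$. $[\omega]^*$ is the family of infinite co-infinite subsets of $\omega$, and $\omega^\omega_{>k}=\{f\in\omega^{\uparrow\omega}: |[f(n),f(n+1))|>k\text{ for all }n\}$. For $\iota\in\{\forall,\exists\}$ and $k<\omega$, $\mathbf{L}_\iota^k=\langle\omega^\omega_{>k},[\omega]^*,\sqsubset_\iota^k\rangle$, where $f\sqsubset_\iota^k X$ iff $\iota^\infty n\; |[f(n),f(n+1))\cap X|\le k$. *)

theory Defs
  imports "HOL-Library.Infinite_Set"
begin

unbundle cardinal_syntax

record ('a, 'b) relsys =
  Left :: "'a set"
  Right :: "'b set"
  Rel :: "'a \<Rightarrow> 'b \<Rightarrow> bool"

text \<open>\<^term>\<open>Rel R\<close> is a predicate on the whole underlying types, but only its values on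
  \<^term>\<open>Left R\<close> and \<^term>\<open>Right R\<close> matter below.\<close>

definition relational_system :: "('a, 'b) relsys \<Rightarrow> bool" where
  "relational_system R \<longleftrightarrow> Left R \<noteq> {} \<and> Right R \<noteq> {}"

definition bounded_in :: "('a, 'b) relsys \<Rightarrow> 'a set \<Rightarrow> bool" where
  "bounded_in R F \<longleftrightarrow> (\<exists>y\<in>Right R. \<forall>x\<in>F. Rel R x y)"

definition dominating_in :: "('a, 'b) relsys \<Rightarrow> 'b set \<Rightarrow> bool" where
  "dominating_in R E \<longleftrightarrow> (\<forall>x\<in>Left R. \<exists>y\<in>E. Rel R x y)"

text \<open>Cardinal numbers are represented by cardinal orders, so they are meaningful up to the relation
  \<open>=o\<close>, which also compares cardinals over different types. The least cardinality of a member of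
  \<open>\<F>\<close> is attained whenever \<open>\<F>\<close> is nonempty (lemma \<open>min_card_least\<close> below), and unspecified
  otherwise.\<close>

definition min_card :: "'a set set \<Rightarrow> 'a rel" where
  "min_card \<F> = (SOME r. \<exists>F\<in>\<F>. r = |F| \<and> (\<forall>G\<in>\<F>. |F| \<le>o |G| ))"

lemma min_card_least:
  assumes "\<F> \<noteq> {}"
  shows "\<exists>F\<in>\<F>. min_card \<F> = |F| \<and> (\<forall>G\<in>\<F>. |F| \<le>o |G| )"
proof -
  have "\<exists>r\<in>card_of ` \<F>. \<forall>r'\<in>card_of ` \<F>. r \<le>o r'"
    using assms by (intro exists_minim_Card_order) (auto simp: card_of_Card_order)
  then have "\<exists>r. \<exists>F\<in>\<F>. r = |F| \<and> (\<forall>G\<in>\<F>. |F| \<le>o |G| )"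
    by blast
  then show ?thesis
    unfolding min_card_def by (rule someI_ex)
qed

definition bnum :: "('a, 'b) relsys \<Rightarrow> 'a rel" where
  "bnum R = min_card {F. F \<subseteq> Left R \<and> \<not> bounded_in R F}"

definition dnum :: "('a, 'b) relsys \<Rightarrow> 'b rel" where
  "dnum R = min_card {E. E \<subseteq> Right R \<and> dominating_in R E}"

definition increasing_funs :: "(nat \<Rightarrow> nat) set" where
  "increasing_funs = {f. strict_mono f}"

definition D_sys :: "(nat \<Rightarrow> nat, nat \<Rightarrow> nat) relsys" where
  "D_sys = \<lparr>Left = increasing_funs, Right = increasing_funs,
     Rel = (\<lambda>x y. \<forall>\<^sub>\<infinity>n. x n \<le> y n)\<rparr>"

definition inf_coinf_sets :: "nat set set" where
  "inf_coinf_sets = {X. infinite X \<and> infinite (- X)}"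

definition gap_funs :: "nat \<Rightarrow> (nat \<Rightarrow> nat) set" where
  "gap_funs k = {f \<in> increasing_funs. \<forall>n. card {f n..<f (Suc n)} > k}"

definition L_all :: "nat \<Rightarrow> (nat \<Rightarrow> nat, nat set) relsys" where
  "L_all k = \<lparr>Left = gap_funs k, Right = inf_coinf_sets,
     Rel = (\<lambda>f X. \<forall>\<^sub>\<infinity>n. card ({f n..<f (Suc n)} \<inter> X) \<le> k)\<rparr>"

definition L_ex :: "nat \<Rightarrow> (nat \<Rightarrow> nat, nat set) relsys" where
  "L_ex k = \<lparr>Left = gap_funs k, Right = inf_coinf_sets,
     Rel = (\<lambda>f X. \<exists>\<^sub>\<infinity>n. card ({f n..<f (Suc n)} \<inter> X) \<le> k)\<rparr>"

lemma increasing_funs_nonempty: "increasing_funs \<noteq> {}"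
  unfolding increasing_funs_def using strict_monoI[of "\<lambda>n::nat. n"] by blast

lemma gap_funs_nonempty: "gap_funs k \<noteq> {}"
proof -
  have "(\<lambda>n. n * Suc k) \<in> gap_funs k"
    by (auto simp: gap_funs_def increasing_funs_def strict_mono_Suc_iff)
  then show ?thesis by blast
qed

lemma inf_coinf_sets_nonempty: "inf_coinf_sets \<noteq> {}"
proof -
  have "infinite {n::nat. even n}"
    unfolding infinite_nat_iff_unbounded_le by (metis dvd_triv_left le_add1 mem_Collect_eq mult_2)
  moreover have "infinite (- {n::nat. even n})"
    unfolding infinite_nat_iff_unbounded_le
    by (metis ComplI even_Suc even_mult_iff even_numeral le_SucI le_add1 mem_Collect_eq mult_2)
  ultimately show ?thesis by (auto simp: inf_coinf_sets_def)
qed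

lemma relational_systems:
  "relational_system D_sys" "relational_system (L_all k)" "relational_system (L_ex k)"
  using increasing_funs_nonempty gap_funs_nonempty inf_coinf_sets_nonempty
  by (simp_all add: relational_system_def D_sys_def L_all_def L_ex_def)

end

theory Submission
  imports Defs
begin

text \<open>All four equalities come from Tukey connections. A Tukey connection from \<open>R\<close> to \<open>R'\<close> carries
  unbounded sets of \<open>R\<close> to unbounded sets of \<open>R'\<close> and dominating sets of \<open>R'\<close> to dominating sets of
  \<open>R\<close>, so two systems connected in both directions have the same two cardinal invariants. Passing to
  the dual system exchanges the two invariants. Hence it is enough to connect \<open>L_all k\<close> with
  \<open>D_sys\<close> for \<open>k > 0\<close>, and \<open>L_ex k\<close> with the dual of \<open>D_sys\<close> for every \<open>k\<close>, in both directions.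

  The combinatorial content is the correspondence between the growth of a function and the
  sparseness of a set.

  \<^item> If \<open>g\<close> eventually dominates the shift of \<open>f\<close>, then iterating \<open>g\<close> produces a set with at most one
    point in almost every interval \<open>[f n, f (n+1))\<close> (\<open>tukey_L_all_D\<close>). This is where \<open>k > 0\<close> enters.
  \<^item> If almost every interval of \<open>f\<close> contains at most \<open>k\<close> points of \<open>X\<close>, then counting the points of
    \<open>X\<close> below \<open>f n\<close> shows that \<open>f\<close> is eventually dominated by the enumeration of \<open>X\<close> along
    multiples of \<open>k + 1\<close> (\<open>tukey_D_L_all\<close>).
  \<^item> If \<open>g\<close> exceeds \<open>n \<mapsto> f (2n)\<close> infinitely often, then infinitely many \<open>n\<close> have at most \<open>n\<close>
    points of the range of \<open>g\<close> to distribute among the first \<open>2n\<close> intervals of \<open>f\<close>, so infinitely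
    many intervals are missed altogether (\<open>tukey_L_ex_dual_D\<close>). Hence \<open>k = 0\<close> is allowed here.
  \<^item> If \<open>x\<close> eventually dominates the function that looks \<open>k + 1\<close> points of \<open>X\<close> ahead, then the
    iterates of \<open>x\<close> cut out intervals which almost all contain more than \<open>k\<close> points of \<open>X\<close>
    (\<open>tukey_dual_D_L_ex\<close>).\<close>

section \<open>Tukey connections and duality\<close>

definition tukey :: "('a, 'b) relsys \<Rightarrow> ('c, 'd) relsys \<Rightarrow> bool" where
  "tukey R R' \<longleftrightarrow> (\<exists>\<phi> \<psi>. (\<forall>x\<in>Left R. \<phi> x \<in> Left R') \<and> (\<forall>y\<in>Right R'. \<psi> y \<in> Right R) \<and>
     (\<forall>x\<in>Left R. \<forall>y\<in>Right R'. Rel R' (\<phi> x) y \<longrightarrow> Rel R x (\<psi> y)))"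

lemma tukeyI:
  assumes "\<And>x. x \<in> Left R \<Longrightarrow> \<phi> x \<in> Left R'" "\<And>y. y \<in> Right R' \<Longrightarrow> \<psi> y \<in> Right R"
    and "\<And>x y. x \<in> Left R \<Longrightarrow> y \<in> Right R' \<Longrightarrow> Rel R' (\<phi> x) y \<Longrightarrow> Rel R x (\<psi> y)"
  shows "tukey R R'"
  unfolding tukey_def using assms by blast

text \<open>In both transfer lemmas the witness is the image under the corresponding half of the
  connection, which cannot have larger cardinality.\<close>

lemma tukey_unbounded:
  assumes "tukey R R'" "F \<subseteq> Left R" "\<not> bounded_in R F"
  shows "\<exists>G. G \<subseteq> Left R' \<and> \<not> bounded_in R' G \<and> |G| \<le>o |F|"
proof -
  from assms(1) obtain \<phi> \<psi> where *: "\<forall>x\<in>Left R. \<phi> x \<in> Left R'" "\<forall>y\<in>Right R'. \<psi> y \<in> Right R"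
     "\<forall>x\<in>Left R. \<forall>y\<in>Right R'. Rel R' (\<phi> x) y \<longrightarrow> Rel R x (\<psi> y)"
    unfolding tukey_def by blast
  have "\<phi> ` F \<subseteq> Left R'" using * assms(2) by blast
  moreover have "\<not> bounded_in R' (\<phi> ` F)"
    using * assms(2,3) unfolding bounded_in_def by (meson image_eqI subsetD)
  ultimately show ?thesis using card_of_image by blast
qed

lemma tukey_dominating:
  assumes "tukey R R'" "E \<subseteq> Right R'" "dominating_in R' E"
  shows "\<exists>G. G \<subseteq> Right R \<and> dominating_in R G \<and> |G| \<le>o |E|"
proof -
  from assms(1) obtain \<phi> \<psi> where *: "\<forall>x\<in>Left R. \<phi> x \<in> Left R'" "\<forall>y\<in>Right R'. \<psi> y \<in> Right R"
     "\<forall>x\<in>Left R. \<forall>y\<in>Right R'. Rel R' (\<phi> x) y \<longrightarrow> Rel R x (\<psi> y)"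
    unfolding tukey_def by blast
  have "\<psi> ` E \<subseteq> Right R" using * assms(2) by blast
  moreover have "dominating_in R (\<psi> ` E)"
    using * assms(2,3) unfolding dominating_in_def by (meson image_eqI subsetD)
  ultimately show ?thesis using card_of_image by blast
qed

lemma min_card_mono:
  assumes "\<F> \<noteq> {}" and "\<And>F. F \<in> \<F> \<Longrightarrow> \<exists>G\<in>\<G>. |G| \<le>o |F|"
  shows "min_card \<G> \<le>o min_card \<F>"
proof -
  obtain F where F: "F \<in> \<F>" "min_card \<F> = |F|" using min_card_least[OF assms(1)] by blast
  obtain G where G: "G \<in> \<G>" "|G| \<le>o |F|" using assms(2)[OF F(1)] by blast
  have "min_card \<G> \<le>o |G|" using min_card_least[of \<G>] G(1) by force
  then show ?thesis using G(2) F(2) ordLeq_transitive by metis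
qed

text \<open>The value of \<^const>\<open>min_card\<close> on the empty family is unspecified, so one of the two systems
  must be known to have an unbounded set and a dominating set at all; the connections then provide
  such sets in the other system.\<close>

lemma tukey_equivalent_invariants:
  assumes t: "tukey R R'" "tukey R' R"
    and nonempty: "\<not> bounded_in R' (Left R')" "dominating_in R' (Right R')"
  shows "bnum R =o bnum R'" and "dnum R =o dnum R'"
proof -
  let ?U = "{F. F \<subseteq> Left R \<and> \<not> bounded_in R F}" and ?U' = "{F. F \<subseteq> Left R' \<and> \<not> bounded_in R' F}"
  have "?U' \<noteq> {}" using nonempty(1) by blast
  moreover have "?U \<noteq> {}" using tukey_unbounded[OF t(2) _ nonempty(1)] by blast
  ultimately have "bnum R \<le>o bnum R'" "bnum R' \<le>o bnum R"
    unfolding bnum_def using tukey_unbounded[OF t(1)] tukey_unbounded[OF t(2)]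
    by (auto intro!: min_card_mono simp del: Collect_empty_eq)
  then show "bnum R =o bnum R'" by (simp add: ordIso_iff_ordLeq)
  let ?E = "{E. E \<subseteq> Right R \<and> dominating_in R E}" and ?E' = "{E. E \<subseteq> Right R' \<and> dominating_in R' E}"
  have "?E' \<noteq> {}" using nonempty(2) by blast
  moreover have "?E \<noteq> {}" using tukey_dominating[OF t(1) _ nonempty(2)] by blast
  ultimately have "dnum R \<le>o dnum R'" "dnum R' \<le>o dnum R"
    unfolding dnum_def using tukey_dominating[OF t(1)] tukey_dominating[OF t(2)]
    by (auto intro!: min_card_mono simp del: Collect_empty_eq)
  then show "dnum R =o dnum R'" by (simp add: ordIso_iff_ordLeq)
qed

definition dual :: "('a, 'b) relsys \<Rightarrow> ('b, 'a) relsys" where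
  "dual R = \<lparr>Left = Right R, Right = Left R, Rel = (\<lambda>y x. \<not> Rel R x y)\<rparr>"

lemma dual_sel [simp]:
  "Left (dual R) = Right R" "Right (dual R) = Left R" "Rel (dual R) y x \<longleftrightarrow> \<not> Rel R x y"
  by (simp_all add: dual_def)

lemma bounded_in_dual [simp]: "bounded_in (dual R) E \<longleftrightarrow> \<not> dominating_in R E"
  by (auto simp: bounded_in_def dominating_in_def)

lemma dominating_in_dual [simp]: "dominating_in (dual R) F \<longleftrightarrow> \<not> bounded_in R F"
  by (auto simp: bounded_in_def dominating_in_def)

lemma invariants_dual: "bnum (dual R) = dnum R" "dnum (dual R) = bnum R"
  by (simp_all add: bnum_def dnum_def)

lemma sel_simps [simp]:
  "Left D_sys = increasing_funs" "Right D_sys = increasing_funs"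
  "Rel D_sys x y \<longleftrightarrow> (\<forall>\<^sub>\<infinity>n. x n \<le> y n)"
  "Left (L_all k) = gap_funs k" "Right (L_all k) = inf_coinf_sets"
  "Rel (L_all k) f X \<longleftrightarrow> (\<forall>\<^sub>\<infinity>n. card ({f n..<f (Suc n)} \<inter> X) \<le> k)"
  "Left (L_ex k) = gap_funs k" "Right (L_ex k) = inf_coinf_sets"
  "Rel (L_ex k) f X \<longleftrightarrow> (\<exists>\<^sub>\<infinity>n. card ({f n..<f (Suc n)} \<inter> X) \<le> k)"
  by (simp_all add: D_sys_def L_all_def L_ex_def)

lemma D_unbounded: "\<not> bounded_in D_sys (Left D_sys)"
proof
  assume "bounded_in D_sys (Left D_sys)"
  then obtain y where y: "y \<in> increasing_funs"
      "\<forall>x\<in>increasing_funs. \<forall>\<^sub>\<infinity>n. x n \<le> y n"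
    unfolding bounded_in_def sel_simps by blast
  have "(\<lambda>n. Suc (y n)) \<in> increasing_funs"
    using y(1) by (simp add: increasing_funs_def strict_mono_def)
  from bspec[OF y(2) this] show False by simp
qed

lemma D_dominating: "dominating_in D_sys (Right D_sys)"
  by (auto simp: dominating_in_def intro!: bexI)

section \<open>Intervals of increasing functions\<close>

text \<open>Gaps of length at least two make the range co-infinite: no successor of a value is a value.\<close>

lemma range_inf_coinf:
  fixes x :: "nat \<Rightarrow> nat"
  assumes gap: "\<And>i. x i + 2 \<le> x (Suc i)"
  shows "range x \<in> inf_coinf_sets"
proof -
  have mono: "strict_mono x" unfolding strict_mono_Suc_iff using gap by (meson less_le_trans less_add_same_cancel1 zero_less_numeral)
  have "infinite (range x)" using mono by (simp add: finite_image_iff strict_mono_imp_inj_on)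
  moreover have "Suc (x i) \<notin> range x" for i
  proof
    assume "Suc (x i) \<in> range x"
    then obtain j where j: "Suc (x i) = x j" by blast
    then have "x i < x j" by simp
    then have "Suc i \<le> j" using mono by (simp add: strict_mono_less Suc_le_eq)
    then have "x (Suc i) \<le> x j" using mono by (simp add: strict_mono_less_eq)
    with gap[of i] j show False by simp
  qed
  then have "(\<lambda>i. Suc (x i)) ` UNIV \<subseteq> - range x" by (intro image_subsetI ComplI) simp
  moreover have "infinite (range (\<lambda>i. Suc (x i)))"
    using mono by (intro range_inj_infinite injI) (simp add: strict_mono_eq)
  ultimately show ?thesis using finite_subset by (auto simp: inf_coinf_sets_def)
qed

lemma card_below_le_imp_le_enumerate:
  fixes X :: "nat set"
  assumes "infinite X" and "card ({..<m} \<inter> X) \<le> i"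
  shows "m \<le> enumerate X i"
proof (rule ccontr)
  assume less: "\<not> m \<le> enumerate X i"
  have "enumerate X ` {..i} \<subseteq> {..<m} \<inter> X"
  proof (intro image_subsetI IntI)
    fix j assume "j \<in> {..i}"
    then have "enumerate X j \<le> enumerate X i" using assms(1) by (simp add: enumerate_mono_le_iff)
    then show "enumerate X j \<in> {..<m}" using less by simp
    show "enumerate X j \<in> X" using assms(1) by (rule enumerate_in_set)
  qed
  then have "card (enumerate X ` {..i}) \<le> card ({..<m} \<inter> X)" by (intro card_mono) auto
  moreover have "card (enumerate X ` {..i}) = Suc i"
    using inj_enumerate[OF assms(1)] by (simp add: card_image inj_on_subset)
  ultimately show False using assms(2) by simp
qed

lemma split_at_increasing:
  fixes f :: "nat \<Rightarrow> nat"
  assumes "strict_mono f"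
  shows "{..<f (Suc n)} \<inter> X = ({..<f n} \<inter> X) \<union> ({f n..<f (Suc n)} \<inter> X)"
  using strict_monoD[OF assms, of n "Suc n"] by auto

lemma card_below_increasing_le:
  fixes f :: "nat \<Rightarrow> nat"
  assumes "strict_mono f" and "\<And>n. n \<ge> N \<Longrightarrow> card ({f n..<f (Suc n)} \<inter> X) \<le> k"
  shows "card ({..<f (N + j)} \<inter> X) \<le> f N + k * j"
proof (induction j)
  case 0
  have "card ({..<f N} \<inter> X) \<le> card {..<f N}" by (intro card_mono) auto
  then show ?case by simp
next
  case (Suc j)
  have "card ({..<f (Suc (N + j))} \<inter> X)
      \<le> card ({..<f (N + j)} \<inter> X) + card ({f (N + j)..<f (Suc (N + j))} \<inter> X)"
    unfolding split_at_increasing[OF assms(1), of "N + j" X] by (rule card_Un_le)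
  also have "\<dots> \<le> (f N + k * j) + k" using Suc assms(2)[of "N + j"] by (intro add_mono) auto
  finally show ?case by (simp add: algebra_simps)
qed

lemma card_below_increasing_ge:
  fixes f :: "nat \<Rightarrow> nat"
  assumes "strict_mono f" and "\<And>n. n \<ge> N \<Longrightarrow> card ({f n..<f (Suc n)} \<inter> X) > 0"
  shows "j \<le> card ({..<f (N + j)} \<inter> X)"
proof (induction j)
  case (Suc j)
  have "card ({..<f (Suc (N + j))} \<inter> X)
      = card ({..<f (N + j)} \<inter> X) + card ({f (N + j)..<f (Suc (N + j))} \<inter> X)"
    unfolding split_at_increasing[OF assms(1), of "N + j" X] by (rule card_Un_disjoint) auto
  then show ?case using Suc assms(2)[of "N + j"] by simp
qed simp

section \<open>Bounding all but finitely many intersections\<close>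

primrec sparse_seq :: "(nat \<Rightarrow> nat) \<Rightarrow> nat \<Rightarrow> nat" where
  "sparse_seq g 0 = 0"
| "sparse_seq g (Suc i) = g (sparse_seq g i) + 2"

text \<open>If \<open>x\<^sub>i\<close> lies in \<open>[f n, f (n+1))\<close>, then \<open>n \<le> f n \<le> x\<^sub>i\<close>, so the next term exceeds
  \<open>g x\<^sub>i \<ge> f (x\<^sub>i + 1) \<ge> f (n+1)\<close> and lies beyond the interval. The increment of two, rather than
  one, keeps the range co-infinite.\<close>

lemma tukey_L_all_D:
  assumes "k > 0"
  shows "tukey (L_all k) D_sys"
proof (rule tukeyI[where \<phi> = "\<lambda>f n. f (Suc n)" and \<psi> = "\<lambda>g. range (sparse_seq g)"])
  fix f assume "f \<in> Left (L_all k)"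
  then show "(\<lambda>n. f (Suc n)) \<in> Left D_sys"
    by (auto simp: gap_funs_def increasing_funs_def strict_mono_def)
next
  fix g assume "g \<in> Right D_sys"
  then have g: "strict_mono g" by (simp add: increasing_funs_def)
  show "range (sparse_seq g) \<in> Right (L_all k)"
    using range_inf_coinf[of "sparse_seq g"] strict_mono_imp_increasing[OF g] by simp
next
  fix f g
  assume "f \<in> Left (L_all k)" "g \<in> Right D_sys" and le: "Rel D_sys (\<lambda>n. f (Suc n)) g"
  then have f: "strict_mono f" and g: "strict_mono g"
    by (auto simp: gap_funs_def increasing_funs_def)
  let ?x = "sparse_seq g"
  have x: "strict_mono ?x" using strict_mono_imp_increasing[OF g]
    by (simp add: strict_mono_Suc_iff) (meson le_imp_less_Suc less_SucI)
  from le obtain N where N: "\<And>m. m \<ge> N \<Longrightarrow> f (Suc m) \<le> g m" by (auto simp: MOST_nat_le)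
  have "card ({f n..<f (Suc n)} \<inter> range ?x) \<le> 1" if "n \<ge> N" for n
  proof -
    have separated: False if "i < j" "f n \<le> ?x i" "?x j < f (Suc n)" for i j
    proof -
      have "n \<le> ?x i" using strict_mono_imp_increasing[OF f, of n] that by linarith
      then have "f (Suc n) \<le> f (Suc (?x i))" using f by (simp add: strict_mono_less_eq)
      also have "\<dots> \<le> g (?x i)" using N \<open>n \<le> ?x i\<close> \<open>n \<ge> N\<close> by simp
      also have "\<dots> < ?x (Suc i)" by simp
      also have "\<dots> \<le> ?x j" using x that by (simp add: strict_mono_less_eq Suc_leI del: sparse_seq.simps)
      finally show False using that by simp
    qed
    have "p = q" if "p \<in> {f n..<f (Suc n)} \<inter> range ?x" "q \<in> {f n..<f (Suc n)} \<inter> range ?x" for p q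
      using that separated by (auto, metis linorder_neqE_nat)
    then show ?thesis by (subst One_nat_def, subst card_le_Suc0_iff_eq) auto
  qed
  then have "\<forall>n\<ge>N. card ({f n..<f (Suc n)} \<inter> range ?x) \<le> k" using assms le_trans by fastforce
  then show "Rel (L_all k) f (range ?x)" by (auto simp: MOST_nat_le)
qed

text \<open>Multiplying by \<open>k + 1\<close> turns an increasing function into one with gaps longer than \<open>k\<close>. From
  some \<open>N\<close> on, each interval contributes at most \<open>k\<close> points, so at most \<open>f N + k n\<close> points of the
  set lie below \<open>f n\<close>; once \<open>n \<ge> f N\<close>, this is at most \<open>(k + 1) n\<close>.\<close>

lemma tukey_D_L_all: "tukey D_sys (L_all k)"
proof (rule tukeyI[where \<phi> = "\<lambda>x n. Suc k * x n" and \<psi> = "\<lambda>X n. enumerate X (Suc k * n)"])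
  fix x assume "x \<in> Left D_sys"
  then have x: "strict_mono x" by (simp add: increasing_funs_def)
  have "Suc k * x n + Suc k \<le> Suc k * x (Suc n)" for n
  proof -
    have "Suc (x n) \<le> x (Suc n)" using strict_monoD[OF x, of n "Suc n"] by simp
    then have "Suc k * Suc (x n) \<le> Suc k * x (Suc n)" by (rule mult_le_mono2)
    then show ?thesis by simp
  qed
  then have "k < Suc k * x (Suc n) - Suc k * x n" for n
    by (metis Suc_le_eq le_diff_conv2 add.commute le_add2 order_trans)
  moreover have "strict_mono (\<lambda>n. Suc k * x n)"
    using x by (simp add: strict_mono_def del: mult_Suc)
  ultimately show "(\<lambda>n. Suc k * x n) \<in> Left (L_all k)"
    by (simp add: gap_funs_def increasing_funs_def del: mult_Suc)
next
  fix X assume "X \<in> Right (L_all k)"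
  then show "(\<lambda>n. enumerate X (Suc k * n)) \<in> Right D_sys"
    by (auto simp: inf_coinf_sets_def increasing_funs_def strict_mono_def
        enumerate_mono_iff simp del: mult_Suc)
next
  fix x X
  assume "x \<in> Left D_sys" "X \<in> Right (L_all k)" and rel: "Rel (L_all k) (\<lambda>n. Suc k * x n) X"
  then have x: "strict_mono x" and X: "infinite X"
    by (auto simp: inf_coinf_sets_def increasing_funs_def)
  let ?f = "\<lambda>n. Suc k * x n"
  have f: "strict_mono ?f" using x by (simp add: strict_mono_def del: mult_Suc)
  from rel obtain N where N: "\<And>n. n \<ge> N \<Longrightarrow> card ({?f n..<?f (Suc n)} \<inter> X) \<le> k"
    by (auto simp: MOST_nat_le simp del: mult_Suc)
  have "x n \<le> enumerate X (Suc k * n)" if n: "n \<ge> max N (?f N)" for n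
  proof -
    have "card ({..<?f (N + (n - N))} \<inter> X) \<le> ?f N + k * (n - N)"
      by (rule card_below_increasing_le[OF f N])
    also have "\<dots> \<le> n + k * n" using n by (intro add_mono mult_le_mono2) auto
    finally have "card ({..<?f n} \<inter> X) \<le> Suc k * n" using n by (simp del: mult_Suc) simp
    then have "?f n \<le> enumerate X (Suc k * n)" by (rule card_below_le_imp_le_enumerate[OF X])
    then show ?thesis by simp
  qed
  then show "Rel D_sys x (\<lambda>n. enumerate X (Suc k * n))"
    unfolding sel_simps MOST_nat_le by blast
qed

section \<open>Bounding infinitely many intersections\<close>

text \<open>Were almost all intervals to meet the range of \<open>2 g\<close>, at least \<open>2 n - N\<close> of its points would
  lie below \<open>f (2 n)\<close>; but whenever \<open>g n > f (2 n)\<close> there are at most \<open>n\<close> of them. The factor two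
  in front of \<open>g\<close> only makes the range co-infinite.\<close>

lemma tukey_L_ex_dual_D: "tukey (L_ex k) (dual D_sys)"
proof (rule tukeyI[where \<phi> = "\<lambda>f n. f (2 * n)" and \<psi> = "\<lambda>g. range (\<lambda>n. 2 * g n)"])
  fix f assume "f \<in> Left (L_ex k)"
  then show "(\<lambda>n. f (2 * n)) \<in> Left (dual D_sys)"
    by (auto simp: gap_funs_def increasing_funs_def strict_mono_def)
next
  fix g assume "g \<in> Right (dual D_sys)"
  then have "g n < g (Suc n)" for n by (simp add: increasing_funs_def strict_mono_def)
  then have "2 * g n + 2 \<le> 2 * g (Suc n)" for n using Suc_leI[of "g n" "g (Suc n)"] by simp
  then show "range (\<lambda>n. 2 * g n) \<in> Right (L_ex k)" by (simp add: range_inf_coinf)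
next
  fix f g
  assume "f \<in> Left (L_ex k)" "g \<in> Right (dual D_sys)" and rel: "Rel (dual D_sys) (\<lambda>n. f (2 * n)) g"
  then have f: "strict_mono f" and g: "strict_mono g"
    by (auto simp: gap_funs_def increasing_funs_def)
  let ?X = "range (\<lambda>n. 2 * g n)"
  show "Rel (L_ex k) f ?X"
  proof (rule ccontr)
    assume "\<not> Rel (L_ex k) f ?X"
    then have "\<forall>\<^sub>\<infinity>n. k < card ({f n..<f (Suc n)} \<inter> ?X)"
      by (simp add: not_INFM not_le)
    then obtain N where "\<forall>n\<ge>N. k < card ({f n..<f (Suc n)} \<inter> ?X)"
      unfolding MOST_nat_le by blast
    then have N: "card ({f n..<f (Suc n)} \<inter> ?X) > 0" if "n \<ge> N" for n
      using that gr_zeroI by fastforce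
    have "\<exists>\<^sub>\<infinity>n. f (2 * n) < g n" using rel by (simp add: not_MOST not_le)
    then obtain n where n: "n > N" "f (2 * n) < g n" unfolding INFM_nat by blast
    have "2 * n - N \<le> card ({..<f (N + (2 * n - N))} \<inter> ?X)"
      by (rule card_below_increasing_ge[OF f N])
    also have "N + (2 * n - N) = 2 * n" using n by simp
    also have "card ({..<f (2 * n)} \<inter> ?X) \<le> card ((\<lambda>i. 2 * g i) ` {..<n})"
    proof (intro card_mono)
      show "{..<f (2 * n)} \<inter> ?X \<subseteq> (\<lambda>i. 2 * g i) ` {..<n}"
      proof
        fix p assume "p \<in> {..<f (2 * n)} \<inter> ?X"
        then obtain i where i: "p = 2 * g i" "p < f (2 * n)" by auto
        then have "g i < g n" using n by simp
        then show "p \<in> (\<lambda>i. 2 * g i) ` {..<n}" using i g by (simp add: strict_mono_less)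
      qed
    qed simp
    also have "\<dots> \<le> n" using card_image_le[of "{..<n}" "\<lambda>i. 2 * g i"] by simp
    finally show False using n by simp
  qed
qed

primrec iterate_gap :: "nat \<Rightarrow> (nat \<Rightarrow> nat) \<Rightarrow> nat \<Rightarrow> nat" where
  "iterate_gap k x 0 = 0"
| "iterate_gap k x (Suc n) = x (iterate_gap k x n) + Suc k"

text \<open>The relation of the dual is a negation, so the connecting implication is proved in
  contrapositive form: writing \<open>a\<close> for the enumeration of \<open>X\<close>, the points
  \<open>a\<^sub>m, \<dots>, a\<^sub>m\<^sub>+\<^sub>k\<close> all lie in \<open>[m, a\<^sub>m\<^sub>+\<^sub>k\<^sub>+\<^sub>1)\<close>, and the interval of the iteration starting at \<open>m\<close>
  reaches past \<open>x m \<ge> a\<^sub>m\<^sub>+\<^sub>k\<^sub>+\<^sub>1\<close> for almost all \<open>m\<close>. The summand \<open>k + 1\<close> makes every gap longer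
  than \<open>k\<close>, whatever \<open>x\<close> is.\<close>

lemma tukey_dual_D_L_ex: "tukey (dual D_sys) (L_ex k)"
proof (rule tukeyI[where \<phi> = "iterate_gap k" and \<psi> = "\<lambda>X m. enumerate X (m + Suc k)"])
  fix x assume "x \<in> Left (dual D_sys)"
  then have x: "m \<le> x m" for m
    by (simp add: increasing_funs_def strict_mono_imp_increasing)
  have "iterate_gap k x n + Suc k \<le> iterate_gap k x (Suc n)" for n using x by simp
  then have "k < iterate_gap k x (Suc n) - iterate_gap k x n" for n
    by (metis Suc_le_eq le_diff_conv2 add.commute le_add1 order_trans)
  then show "iterate_gap k x \<in> Left (L_ex k)"
    by (auto simp: gap_funs_def increasing_funs_def strict_mono_Suc_iff simp del: iterate_gap.simps)
      (metis zero_less_diff gr_implies_not0 gr0I)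
next
  fix X assume "X \<in> Right (L_ex k)"
  then show "(\<lambda>m. enumerate X (m + Suc k)) \<in> Right (dual D_sys)"
    by (auto simp: inf_coinf_sets_def increasing_funs_def strict_mono_def enumerate_mono_iff)
next
  fix x X
  assume "x \<in> Left (dual D_sys)" "X \<in> Right (L_ex k)" and rel: "Rel (L_ex k) (iterate_gap k x) X"
  then have x: "\<And>m. m \<le> x m" and X: "infinite X"
    by (auto simp: inf_coinf_sets_def increasing_funs_def strict_mono_imp_increasing)
  let ?f = "iterate_gap k x"
  show "Rel (dual D_sys) x (\<lambda>m. enumerate X (m + Suc k))"
  proof (rule ccontr)
    assume "\<not> Rel (dual D_sys) x (\<lambda>m. enumerate X (m + Suc k))"
    then obtain N where N: "\<forall>m\<ge>N. enumerate X (m + Suc k) \<le> x m"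
      unfolding dual_sel sel_simps not_not MOST_nat_le by blast
    have "?f n < ?f (Suc n)" for n using x[of "?f n"] by simp
    then have f: "strict_mono ?f" by (simp add: strict_mono_Suc_iff del: iterate_gap.simps)
    have "k < card ({?f n..<?f (Suc n)} \<inter> X)" if "n \<ge> N" for n
    proof -
      let ?m = "?f n"
      have m: "N \<le> ?m" using strict_mono_imp_increasing[OF f, of n] that by linarith
      have "enumerate X ` {?m..?m + k} \<subseteq> {?m..<?f (Suc n)} \<inter> X"
      proof (intro image_subsetI IntI)
        fix i assume i: "i \<in> {?m..?m + k}"
        have "i \<le> enumerate X i" using X by (rule le_enumerate)
        moreover have "enumerate X i < enumerate X (?m + Suc k)"
          using X i by (simp add: enumerate_mono_iff)
        moreover have "enumerate X (?m + Suc k) \<le> x ?m" using N m by blast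
        ultimately show "enumerate X i \<in> {?m..<?f (Suc n)}" using i by simp
        show "enumerate X i \<in> X" using X by (rule enumerate_in_set)
      qed
      then have "card (enumerate X ` {?m..?m + k}) \<le> card ({?m..<?f (Suc n)} \<inter> X)"
        by (intro card_mono) auto
      moreover have "card (enumerate X ` {?m..?m + k}) = Suc k"
        using inj_enumerate[OF X] by (simp add: card_image inj_on_subset)
      ultimately show ?thesis by simp
    qed
    then have "\<forall>\<^sub>\<infinity>n. k < card ({?f n..<?f (Suc n)} \<inter> X)" unfolding MOST_nat_le by blast
    then have "\<not> Rel (L_ex k) ?f X" unfolding sel_simps not_INFM not_le .
    then show False using rel by blast
  qed
qed

section \<open>The cardinal invariants\<close>

theorem theoremC:
  shows "(\<forall>k>0. bnum (L_all k) =o bnum D_sys \<and> dnum (L_all k) =o dnum D_sys) \<and>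
         (\<forall>k. bnum (L_ex k) =o dnum D_sys \<and> dnum (L_ex k) =o bnum D_sys)"
proof (intro conjI allI impI)
  fix k :: nat assume "k > 0"
  note tukey_inv = tukey_equivalent_invariants[OF tukey_L_all_D[OF \<open>k > 0\<close>] tukey_D_L_all
      D_unbounded D_dominating]
  show "bnum (L_all k) =o bnum D_sys" by (rule tukey_inv(1))
  show "dnum (L_all k) =o dnum D_sys" by (rule tukey_inv(2))
next
  fix k
  have "\<not> bounded_in (dual D_sys) (Left (dual D_sys))"
    using D_dominating by (simp del: sel_simps)
  moreover have "dominating_in (dual D_sys) (Right (dual D_sys))"
    using D_unbounded by (simp del: sel_simps)
  ultimately have "bnum (L_ex k) =o bnum (dual D_sys)" "dnum (L_ex k) =o dnum (dual D_sys)"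
    using tukey_equivalent_invariants[OF tukey_L_ex_dual_D tukey_dual_D_L_ex] by blast+
  then show "bnum (L_ex k) =o dnum D_sys" "dnum (L_ex k) =o bnum D_sys"
    by (simp_all add: invariants_dual)
qed

end
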